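(* Let $K$ be a field, $R = K[x_1, \ldots, x_m, y_1, \ldots, y_n]$, and let $I_\lambda\subseteq R$ be the Ferrers ideal associated to a Ferrers graph $G_\lambda$ with associated partition $\lambda = (\lambda_1=n, \lambda_2,\ldots, \lambda_m)$. Then a primary decomposition of the LCM-dual $\widehat {I_\lambda}$ is given by $$\widehat{I_\lambda} = \bigcap_{1\le i<j\le m} (x_i, x_j) \;\cap\; \bigcap_{1\le i<j\le n} (y_i, y_j) \;\cap \bigcap_{\substack{1 \leq i \leq m \\ 1 \leq j \leq n \\ x_iy_j \not \in I_\lambda}} (x_i, y_j).$$ Therefore $\widehat{I_\lambda}=(I(G_\lambda^c))^\star$, the Alexander dual of the edge ideal of the complement of $G_\lambda$.
   Context: LCM-dual: for a monomial ideal $I$ with minimal monomial generators $f_1,\ldots,f_\nu$ and $m_I = \operatorname{lcm}(f_1,\ldots,f_\nu)$, $\widehat I$ is the ideal generated by $m_I/f_1,\ldots,m_I/f_\nu$. Ferrers graph: a bipartite graph on the vertex partition $\{x_1,\ldots,x_m\}$, $\{y_1,\ldots,y_n\}$ such that if $\{x_i,y_j\}$ is an edge then so is $\{x_p,y_q\}$ for all $1\le p\le i$, $1\le q\le j$, and moreover $\{x_1,y_n\}$ and $\{x_m,y_1\}$ are edges. Its associated partition is $\lambda=(\lambda_1,\ldots,\lambda_m)$ with $\lambda_i$ the degree of the vertex $x_i$. The edge ideal $I(G)$ of a finite simple graph $G$ is the ideal generated by the products of the two vertices (variables) of each edge. The Ferrers ideal $I_\lambda$ is the edge ideal of the Ferrers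 graph $G_\lambda$. The complement $G^c$ of a graph $G$ has the same vertex set, and two distinct vertices form an edge of $G^c$ if and only if they do not form an edge of $G$. Alexander dual: for a squarefree monomial ideal $I$ with minimal generators $\prod_{z\in\sigma_1} z,\ldots,\prod_{z\in\sigma_r}z$ (each $\sigma_k$ a set of variables), $I^\star = \mathfrak p_{\sigma_1}\cap\cdots\cap\mathfrak p_{\sigma_r}$, where $\mathfrak p_\sigma$ is the prime ideal generated by the variables in $\sigma$. An empty intersection of ideals is the whole ring $R$. *)

theory Defs
  imports "HOL-Library.Poly_Mapping" "HOL-Algebra.Ideal"
begin

section \<open>Polynomial rings and monomials\<close>

text \<open>
  A power product in variables of type \<open>'v\<close> is its exponent vector \<open>'v \<Rightarrow>\<^sub>0 nat\<close>, and a
  polynomial with coefficients in \<open>'k\<close> is a finitely supported map from power products to \<open>'k\<close>.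
  The type has a variable for every element of \<open>'v\<close>; the ring \<open>K[V]\<close> on a set \<open>V\<close> of variables
  is carved out by its carrier, so that ideals below are ideals of \<open>K[V]\<close>.
\<close>

type_synonym ('v, 'k) poly_fn = "('v \<Rightarrow>\<^sub>0 nat) \<Rightarrow>\<^sub>0 'k"

definition poly_ring :: "'v set \<Rightarrow> ('v, 'k::field) poly_fn ring" where
  "poly_ring V = \<lparr>carrier = {p. \<forall>t\<in>Poly_Mapping.keys p. Poly_Mapping.keys t \<subseteq> V},
     mult = (*), one = 1, zero = 0, add = (+)\<rparr>"

definition monomial :: "('v \<Rightarrow>\<^sub>0 nat) \<Rightarrow> ('v, 'k::field) poly_fn" where
  "monomial t = Poly_Mapping.single t 1"

definition var :: "'v \<Rightarrow> ('v, 'k::field) poly_fn" where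
  "var z = monomial (Poly_Mapping.single z 1)"

section \<open>Minimal monomial generators, LCM-dual and Alexander dual\<close>

text \<open>Sets of monomials are represented by the sets of their exponent vectors.\<close>

definition is_min_mon_gens ::
    "('v, 'k::field) poly_fn ring \<Rightarrow> ('v, 'k) poly_fn set \<Rightarrow> ('v \<Rightarrow>\<^sub>0 nat) set \<Rightarrow> bool" where
  "is_min_mon_gens R I S \<longleftrightarrow>
     monomial ` S \<subseteq> carrier R \<and> Idl\<^bsub>R\<^esub> (monomial ` S) = I \<and> (\<forall>T. T \<subset> S \<longrightarrow> Idl\<^bsub>R\<^esub> (monomial ` T) \<noteq> I)"

text \<open>
  Well defined for every monomial ideal, see \<open>is_min_mon_gens_unique\<close> below.
\<close>

definition min_mon_gens ::
    "('v, 'k::field) poly_fn ring \<Rightarrow> ('v, 'k) poly_fn set \<Rightarrow> ('v \<Rightarrow>\<^sub>0 nat) set" where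
  "min_mon_gens R I = (THE S. is_min_mon_gens R I S)"

text \<open>
  The exponent of each variable is the maximal one occurring in \<open>S\<close>, and \<open>0\<close> if \<open>S\<close> is empty;
  see \<open>lookup_lcm_exp\<close>. Meant for finite \<open>S\<close>.
\<close>

definition lcm_exp :: "('v \<Rightarrow>\<^sub>0 nat) set \<Rightarrow> ('v \<Rightarrow>\<^sub>0 nat)" where
  "lcm_exp S = Abs_poly_mapping (\<lambda>z. SUP t\<in>S. Poly_Mapping.lookup t z)"

text \<open>The quotient of monomials \<open>m/f\<close>, for \<open>f\<close> dividing \<open>m\<close>, has exponent vector \<open>m - f\<close>.\<close>

definition lcm_dual ::
    "('v, 'k::field) poly_fn ring \<Rightarrow> ('v, 'k) poly_fn set \<Rightarrow> ('v, 'k) poly_fn set" where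
  "lcm_dual R I = Idl\<^bsub>R\<^esub> {monomial (lcm_exp (min_mon_gens R I) - f) | f. f \<in> min_mon_gens R I}"

text \<open>
  Meant for squarefree monomial ideals: the minimal generators are then the products
  \<open>\<Prod>z\<in>\<sigma>. z\<close>, whose exponent vectors are \<open>\<Sum>z\<in>\<sigma>. Poly_Mapping.single z 1\<close>.
  Intersecting with the carrier makes the empty intersection the whole ring.
\<close>

definition alexander_dual ::
    "('v, 'k::field) poly_fn ring \<Rightarrow> ('v, 'k) poly_fn set \<Rightarrow> ('v, 'k) poly_fn set" where
  "alexander_dual R I = carrier R \<inter>
     \<Inter>{Idl\<^bsub>R\<^esub> (var ` \<sigma>) | \<sigma>. finite \<sigma> \<and> (\<Sum>z\<in>\<sigma>. Poly_Mapping.single z 1) \<in> min_mon_gens R I}"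

section \<open>Primary decompositions\<close>

definition primary_ideal :: "('a, 'b) ring_scheme \<Rightarrow> 'a set \<Rightarrow> bool" where
  "primary_ideal R Q \<longleftrightarrow> ideal Q R \<and> Q \<noteq> carrier R \<and>
     (\<forall>a\<in>carrier R. \<forall>b\<in>carrier R.
        a \<otimes>\<^bsub>R\<^esub> b \<in> Q \<longrightarrow> a \<in> Q \<or> (\<exists>k::nat. k \<ge> 1 \<and> b [^]\<^bsub>R\<^esub> k \<in> Q))"

text \<open>No irredundancy is required. The empty family decomposes the whole ring.\<close>

definition primary_decomposition :: "('a, 'b) ring_scheme \<Rightarrow> 'a set \<Rightarrow> 'a set set \<Rightarrow> bool" where
  "primary_decomposition R I \<Q> \<longleftrightarrow>
     finite \<Q> \<and> (\<forall>Q\<in>\<Q>. primary_ideal R Q) \<and> I = carrier R \<inter> \<Inter>\<Q>"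

section \<open>Graphs, edge ideals, Ferrers graphs\<close>

type_synonym 'v ugraph = "'v set \<times> 'v set set"

abbreviation verts :: "'v ugraph \<Rightarrow> 'v set" where "verts G \<equiv> fst G"
abbreviation edges :: "'v ugraph \<Rightarrow> 'v set set" where "edges G \<equiv> snd G"

definition simple_graph :: "'v ugraph \<Rightarrow> bool" where
  "simple_graph G \<longleftrightarrow> finite (verts G) \<and> (\<forall>e\<in>edges G. e \<subseteq> verts G \<and> card e = 2)"

definition vertex_degree :: "'v ugraph \<Rightarrow> 'v \<Rightarrow> nat" where
  "vertex_degree G v = card {e \<in> edges G. v \<in> e}"

definition graph_complement :: "'v ugraph \<Rightarrow> 'v ugraph" where
  "graph_complement G =
     (verts G, {{u, v} | u v. u \<in> verts G \<and> v \<in> verts G \<and> u \<noteq> v \<and> {u, v} \<notin> edges G})"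

definition edge_ideal :: "('v, 'k::field) poly_fn ring \<Rightarrow> 'v ugraph \<Rightarrow> ('v, 'k) poly_fn set" where
  "edge_ideal R G = Idl\<^bsub>R\<^esub> {var u * var v | u v. {u, v} \<in> edges G}"

text \<open>The variables \<open>x\<^sub>i\<close> and \<open>y\<^sub>j\<close>; indices start at 1.\<close>

datatype xyvar = X nat | Y nat

definition xyvars :: "nat \<Rightarrow> nat \<Rightarrow> xyvar set" where
  "xyvars m n = X ` {1..m} \<union> Y ` {1..n}"

text \<open>The last two conditions force \<open>m \<ge> 1\<close> and \<open>n \<ge> 1\<close>.\<close>

definition ferrers_graph :: "nat \<Rightarrow> nat \<Rightarrow> xyvar ugraph \<Rightarrow> bool" where
  "ferrers_graph m n G \<longleftrightarrow>
     verts G = xyvars m n \<and>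
     edges G \<subseteq> {{X i, Y j} | i j. i \<in> {1..m} \<and> j \<in> {1..n}} \<and>
     (\<forall>i j p q. {X i, Y j} \<in> edges G \<and> 1 \<le> p \<and> p \<le> i \<and> 1 \<le> q \<and> q \<le> j \<longrightarrow> {X p, Y q} \<in> edges G) \<and>
     {X 1, Y n} \<in> edges G \<and> {X m, Y 1} \<in> edges G"

definition ferrers_partition :: "nat \<Rightarrow> xyvar ugraph \<Rightarrow> nat list" where
  "ferrers_partition m G = map (\<lambda>i. vertex_degree G (X i)) [1..<Suc m]"

section \<open>Sanity checks\<close>

lemma poly_ring_simps [simp]:
  "carrier (poly_ring V) = {p. \<forall>t\<in>Poly_Mapping.keys p. Poly_Mapping.keys t \<subseteq> V}"
  "p \<otimes>\<^bsub>poly_ring V\<^esub> q = p * q" "p \<oplus>\<^bsub>poly_ring V\<^esub> q = p + q"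
  "\<one>\<^bsub>poly_ring V\<^esub> = 1" "\<zero>\<^bsub>poly_ring V\<^esub> = 0"
  by (simp_all add: poly_ring_def)

lemma keys_add_exp: "Poly_Mapping.keys (s + t :: 'v \<Rightarrow>\<^sub>0 nat) = Poly_Mapping.keys s \<union> Poly_Mapping.keys t"
  by (auto simp: in_keys_iff lookup_add)

lemma poly_ring_mult_closed:
  assumes "\<forall>t\<in>Poly_Mapping.keys p. Poly_Mapping.keys t \<subseteq> V" "\<forall>t\<in>Poly_Mapping.keys q. Poly_Mapping.keys t \<subseteq> V"
  shows "\<forall>t\<in>Poly_Mapping.keys (p * q :: ('v, 'k::field) poly_fn). Poly_Mapping.keys t \<subseteq> V"
proof
  fix t assume "t \<in> Poly_Mapping.keys (p * q)"
  then obtain a b where "t = a + b" "a \<in> Poly_Mapping.keys p" "b \<in> Poly_Mapping.keys q"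
    using keys_mult[of p q] by blast
  then show "Poly_Mapping.keys t \<subseteq> V" using assms by (simp add: keys_add_exp)
qed

lemma cring_poly_ring: "cring (poly_ring V :: ('v, 'k::field) poly_fn ring)"
proof (rule cringI)
  show "abelian_group (poly_ring V :: ('v, 'k) poly_fn ring)"
  proof (rule abelian_groupI)
    fix x y assume "x \<in> carrier (poly_ring V :: ('v, 'k) poly_fn ring)"
      "y \<in> carrier (poly_ring V :: ('v, 'k) poly_fn ring)"
    then show "x \<oplus>\<^bsub>poly_ring V\<^esub> y \<in> carrier (poly_ring V)"
      using Poly_Mapping.keys_add[of x y] by auto
  next
    fix x assume "x \<in> carrier (poly_ring V :: ('v, 'k) poly_fn ring)"
    then show "\<exists>y\<in>carrier (poly_ring V). y \<oplus>\<^bsub>poly_ring V\<^esub> x = \<zero>\<^bsub>poly_ring V\<^esub>"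
      by (intro bexI[of _ "- x"]) auto
  qed (auto simp: algebra_simps)
  show "comm_monoid (poly_ring V :: ('v, 'k) poly_fn ring)"
    proof (rule comm_monoidI)
    fix x y assume "x \<in> carrier (poly_ring V :: ('v, 'k) poly_fn ring)"
      "y \<in> carrier (poly_ring V :: ('v, 'k) poly_fn ring)"
    then show "x \<otimes>\<^bsub>poly_ring V\<^esub> y \<in> carrier (poly_ring V)"
      using poly_ring_mult_closed[of x V y] by simp
  qed (auto simp: algebra_simps)
qed (auto simp: algebra_simps)

lemma mon_mult: "monomial s * monomial t = (monomial (s + t) :: ('v, 'k::field) poly_fn)"
  by (simp add: monomial_def mult_single)

lemma keys_mon [simp]: "Poly_Mapping.keys (monomial t :: ('v, 'k::field) poly_fn) = {t}"
  by (simp add: monomial_def)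

lemma mon_in_Idl_iff:
  fixes V :: "'v set"
  defines "R \<equiv> poly_ring V :: ('v, 'k::field) poly_fn ring"
  assumes A: "\<forall>a\<in>A. Poly_Mapping.keys a \<subseteq> V"
  shows "monomial t \<in> Idl\<^bsub>R\<^esub> (monomial ` A) \<longleftrightarrow> Poly_Mapping.keys t \<subseteq> V \<and> (\<exists>a\<in>A. \<exists>c. t = a + c)"
proof -
  interpret cring R unfolding R_def by (rule cring_poly_ring)
  define J where "J = {p \<in> carrier R. \<forall>t\<in>Poly_Mapping.keys p. \<exists>a\<in>A. \<exists>c. t = a + c}"
  have sub: "monomial ` A \<subseteq> carrier R" using A by (auto simp: R_def)
  have J: "ideal J R"
  proof (rule idealI)
    show "ring R" by (rule ring_axioms)
    show "subgroup J (add_monoid R)"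
    proof (rule subgroup.intro)
      fix x y assume "x \<in> J" "y \<in> J"
      then show "x \<otimes>\<^bsub>add_monoid R\<^esub> y \<in> J"
        using Poly_Mapping.keys_add[of x y] by (fastforce simp: J_def R_def)
    next
      fix x assume x: "x \<in> J"
      have "\<ominus>\<^bsub>R\<^esub> x = - x"
        using x by (intro minus_equality) (auto simp: J_def R_def)
      then show "inv\<^bsub>add_monoid R\<^esub> x \<in> J"
        using x unfolding a_inv_def[symmetric] by (auto simp: J_def R_def)
    qed (auto simp: J_def R_def)
    have *: "x * a \<in> J" if a: "a \<in> J" and x: "x \<in> carrier R" for a x
    proof -
      have "\<exists>b\<in>A. \<exists>c. t = b + c" if t: "t \<in> Poly_Mapping.keys (x * a)" for t
      proof -
        obtain u v where uv: "t = u + v" "v \<in> Poly_Mapping.keys a" using keys_mult[of x a] t by blast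
        then obtain b c where "b \<in> A" "v = b + c" using a by (auto simp: J_def)
        then have "t = b + (u + c)" using uv by (simp add: algebra_simps)
        then show ?thesis using \<open>b \<in> A\<close> by blast
      qed
      moreover have "x * a \<in> carrier R" using m_closed[of x a] a x by (simp add: J_def R_def)
      ultimately show ?thesis by (auto simp: J_def)
    qed
    then show "x \<otimes>\<^bsub>R\<^esub> a \<in> J" if "a \<in> J" "x \<in> carrier R" for a x
      using that by (simp add: R_def)
    show "a \<otimes>\<^bsub>R\<^esub> x \<in> J" if "a \<in> J" "x \<in> carrier R" for a x
      using *[OF that] by (simp add: R_def mult.commute)
  qed
  have "monomial ` A \<subseteq> J" using A by (auto simp: J_def R_def) (metis add.right_neutral)
  then have "Idl\<^bsub>R\<^esub> (monomial ` A) \<subseteq> J" using genideal_minimal[OF J] by blast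
  moreover have "monomial t \<in> Idl\<^bsub>R\<^esub> (monomial ` A)" if "Poly_Mapping.keys t \<subseteq> V" "a \<in> A" "t = a + c" for a c
  proof -
    have "monomial a \<in> Idl\<^bsub>R\<^esub> (monomial ` A)" using genideal_self[OF sub] that by blast
    moreover have "monomial c \<in> carrier R" using that by (simp add: R_def keys_add_exp)
    ultimately have "monomial a \<otimes>\<^bsub>R\<^esub> monomial c \<in> Idl\<^bsub>R\<^esub> (monomial ` A)"
      using ideal.I_r_closed[OF genideal_ideal[OF sub]] by blast
    then show ?thesis using that by (simp add: R_def mon_mult)
  qed
  moreover have "monomial t \<in> J \<longleftrightarrow> Poly_Mapping.keys t \<subseteq> V \<and> (\<exists>a\<in>A. \<exists>c. t = a + c)"
    by (simp add: J_def R_def)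
  ultimately show ?thesis by blast
qed

lemma exp_antisym: "a = b + c \<Longrightarrow> b = a + d \<Longrightarrow> a = (b :: 'v \<Rightarrow>\<^sub>0 nat)"
  by (simp add: poly_mapping_eq_iff fun_eq_iff lookup_add)

lemma min_divisor_exists:
  fixes a :: "'v \<Rightarrow>\<^sub>0 nat"
  assumes "a \<in> A"
  shows "\<exists>b\<in>A. (\<forall>d\<in>A. (\<exists>c. b = d + c) \<longrightarrow> d = b) \<and> (\<exists>c. a = b + c)"
  using assms
proof (induction "\<Sum>z\<in>Poly_Mapping.keys a. Poly_Mapping.lookup a z" arbitrary: a rule: less_induct)
  case less
  show ?case
  proof (cases "\<forall>d\<in>A. (\<exists>c. a = d + c) \<longrightarrow> d = a")
    case True
    then show ?thesis using less.prems by (intro bexI[of _ a]) (auto intro: exI[of _ 0])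
  next
    case False
    then obtain d c where d: "d \<in> A" "a = d + c" "d \<noteq> a" by auto
    then have "c \<noteq> 0" by auto
    then obtain z where z: "z \<in> Poly_Mapping.keys c" by (metis keys_eq_empty ex_in_conv)
    have "(\<Sum>z\<in>Poly_Mapping.keys d. Poly_Mapping.lookup d z) = (\<Sum>z\<in>Poly_Mapping.keys a. Poly_Mapping.lookup d z)"
      using d by (intro sum.mono_neutral_left) (auto simp: keys_add_exp in_keys_iff)
    also have "\<dots> < (\<Sum>z\<in>Poly_Mapping.keys a. Poly_Mapping.lookup a z)"
      using d z by (intro sum_strict_mono_ex1)
        (auto simp: lookup_add keys_add_exp in_keys_iff intro!: bexI[of _ z])
    finally obtain b e where b: "b \<in> A" "\<forall>d\<in>A. (\<exists>c. b = d + c) \<longrightarrow> d = b" "d = b + e"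
      using less.hyps d(1) by blast
    have "a = b + (e + c)" using d b(3) by (simp add: algebra_simps)
    then show ?thesis using b by blast
  qed
qed

lemma is_min_mon_gens_iff:
  fixes V :: "'v set"
  defines "R \<equiv> poly_ring V :: ('v, 'k::field) poly_fn ring"
  assumes A: "\<forall>a\<in>A. Poly_Mapping.keys a \<subseteq> V"
  shows "is_min_mon_gens R (Idl\<^bsub>R\<^esub> (monomial ` A)) S \<longleftrightarrow>
           S = {a \<in> A. \<forall>d\<in>A. (\<exists>c. a = d + c) \<longrightarrow> d = a}"
proof -
  interpret cring R unfolding R_def by (rule cring_poly_ring)
  define M where "M = {a \<in> A. \<forall>d\<in>A. (\<exists>c. a = d + c) \<longrightarrow> d = a}"
  have subA: "monomial ` A \<subseteq> carrier R" using A by (auto simp: R_def)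
  have subM: "monomial ` M \<subseteq> carrier R" using A by (auto simp: R_def M_def)
  have in_iff: "monomial t \<in> Idl\<^bsub>R\<^esub> (monomial ` B) \<longleftrightarrow> Poly_Mapping.keys t \<subseteq> V \<and> (\<exists>a\<in>B. \<exists>c. t = a + c)"
    if "monomial ` B \<subseteq> carrier R" for B t
    unfolding R_def by (rule mon_in_Idl_iff) (use that in \<open>simp add: R_def image_subset_iff\<close>)
  have eq: "Idl\<^bsub>R\<^esub> (monomial ` M) = Idl\<^bsub>R\<^esub> (monomial ` A)"
  proof
    have "monomial ` M \<subseteq> Idl\<^bsub>R\<^esub> (monomial ` A)" using genideal_self[OF subA] by (auto simp: M_def)
    then show "Idl\<^bsub>R\<^esub> (monomial ` M) \<subseteq> Idl\<^bsub>R\<^esub> (monomial ` A)"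
      by (intro genideal_minimal genideal_ideal subA)
    have "monomial a \<in> Idl\<^bsub>R\<^esub> (monomial ` M)" if a: "a \<in> A" for a
    proof -
      obtain b where "b \<in> M" "\<exists>c. a = b + c"
        using min_divisor_exists[OF a] by (auto simp: M_def)
      then show ?thesis using A a by (auto simp: in_iff[OF subM])
    qed
    then have "monomial ` A \<subseteq> Idl\<^bsub>R\<^esub> (monomial ` M)" by blast
    then show "Idl\<^bsub>R\<^esub> (monomial ` A) \<subseteq> Idl\<^bsub>R\<^esub> (monomial ` M)"
      by (intro genideal_minimal genideal_ideal subM)
  qed
  have minM: "Idl\<^bsub>R\<^esub> (monomial ` T) \<noteq> Idl\<^bsub>R\<^esub> (monomial ` A)" if "T \<subset> M" for T
  proof
    assume E: "Idl\<^bsub>R\<^esub> (monomial ` T) = Idl\<^bsub>R\<^esub> (monomial ` A)"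
    obtain b where b: "b \<in> M" "b \<notin> T" using \<open>T \<subset> M\<close> by blast
    have subT: "monomial ` T \<subseteq> carrier R" using subM that by blast
    have "monomial b \<in> Idl\<^bsub>R\<^esub> (monomial ` T)" unfolding E using genideal_self[OF subA] b by (auto simp: M_def)
    then obtain t c where "t \<in> T" "b = t + c" using in_iff[OF subT] by blast
    then have "t = b" using b that by (auto simp: M_def)
    then show False using \<open>t \<in> T\<close> b by blast
  qed
  have uniq: "S = M" if S: "is_min_mon_gens R (Idl\<^bsub>R\<^esub> (monomial ` A)) S"
  proof -
    have subS: "monomial ` S \<subseteq> carrier R" and ES: "Idl\<^bsub>R\<^esub> (monomial ` S) = Idl\<^bsub>R\<^esub> (monomial ` A)"
      using S by (auto simp: is_min_mon_gens_def)
    have "M \<subseteq> S"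
    proof
      fix b assume b: "b \<in> M"
      have "monomial b \<in> Idl\<^bsub>R\<^esub> (monomial ` S)"
        unfolding ES using genideal_self[OF subA] b by (auto simp: M_def)
      then obtain s c where s: "s \<in> S" "b = s + c" using in_iff[OF subS] by blast
      have "monomial s \<in> Idl\<^bsub>R\<^esub> (monomial ` A)"
        using genideal_self[OF subS] s ES by blast
      then obtain a e where a: "a \<in> A" "s = a + e" using in_iff[OF subA] by blast
      have "b = a + (e + c)" using s a by (simp add: algebra_simps)
      then have "a = b" using b a(1) by (auto simp: M_def)
      then have "s = b" using a s exp_antisym by blast
      then show "b \<in> S" using s by blast
    qed
    moreover have "\<not> M \<subset> S" using S eq by (auto simp: is_min_mon_gens_def)
    ultimately show ?thesis by blast
  qed
  have "is_min_mon_gens R (Idl\<^bsub>R\<^esub> (monomial ` A)) M"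
    using subM eq minM by (auto simp: is_min_mon_gens_def)
  then show ?thesis using uniq unfolding M_def by blast
qed

lemma is_min_mon_gens_unique:
  fixes V :: "'v set"
  defines "R \<equiv> poly_ring V :: ('v, 'k::field) poly_fn ring"
  assumes "\<forall>a\<in>A. Poly_Mapping.keys a \<subseteq> V"
  shows "\<exists>!S. is_min_mon_gens R (Idl\<^bsub>R\<^esub> (monomial ` A)) S"
  unfolding R_def by (subst is_min_mon_gens_iff) (use assms in auto)

lemma lookup_lcm_exp:
  fixes S :: "('v \<Rightarrow>\<^sub>0 nat) set"
  assumes "finite S"
  shows "Poly_Mapping.lookup (lcm_exp S) z = (if S = {} then 0 else Max ((\<lambda>t. Poly_Mapping.lookup t z) ` S))"
proof -
  have "{z. (SUP t\<in>S. Poly_Mapping.lookup t z) \<noteq> 0} \<subseteq> (\<Union>t\<in>S. Poly_Mapping.keys t)"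
  proof
    fix z assume "z \<in> {z. (SUP t\<in>S. Poly_Mapping.lookup t z) \<noteq> 0}"
    then have *: "(SUP t\<in>S. Poly_Mapping.lookup t z) \<noteq> 0" by simp
    have "\<exists>t\<in>S. Poly_Mapping.lookup t z \<noteq> 0"
    proof (rule ccontr)
      assume "\<not> ?thesis"
      then have "(\<lambda>t. Poly_Mapping.lookup t z) ` S \<subseteq> {0}" by auto
      then have "(\<lambda>t. Poly_Mapping.lookup t z) ` S = {} \<or> (\<lambda>t. Poly_Mapping.lookup t z) ` S = {0}"
        by (rule subset_singletonD)
      then show False using * by (metis cSup_singleton Sup_nat_empty)
    qed
    then show "z \<in> (\<Union>t\<in>S. Poly_Mapping.keys t)" by (auto simp: in_keys_iff)
  qed
  then have "finite {z. (SUP t\<in>S. Poly_Mapping.lookup t z) \<noteq> 0}"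
    by (rule finite_subset) (use assms in auto)
  then show ?thesis
    unfolding lcm_exp_def by (simp add: Abs_poly_mapping_inverse Sup_nat_def)
qed

lemma simple_graph_ferrers_graph: "ferrers_graph m n G \<Longrightarrow> simple_graph G"
proof -
  assume G: "ferrers_graph m n G"
  have "e \<subseteq> verts G \<and> card e = 2" if "e \<in> edges G" for e
  proof -
    obtain i j where "e = {X i, Y j}" "i \<in> {1..m}" "j \<in> {1..n}"
      using G \<open>e \<in> edges G\<close> unfolding ferrers_graph_def by blast
    then show ?thesis using G by (auto simp: ferrers_graph_def xyvars_def)
  qed
  then show ?thesis using G by (simp add: simple_graph_def ferrers_graph_def xyvars_def)
qed

lemma simple_graph_complement: "simple_graph G \<Longrightarrow> simple_graph (graph_complement G)"
  by (auto simp: simple_graph_def graph_complement_def)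

lemma ferrers_partition_first:
  assumes G: "ferrers_graph m n G"
  shows "ferrers_partition m G ! 0 = n"
proof -
  have 1: "{X 1, Y n} \<in> edges G" "{X m, Y 1} \<in> edges G" using G by (auto simp: ferrers_graph_def)
  have "m \<ge> 1" "n \<ge> 1" using G 1 by (auto simp: ferrers_graph_def doubleton_eq_iff)
  have "{e \<in> edges G. X 1 \<in> e} = (\<lambda>j. {X 1, Y j}) ` {1..n}"
  proof
    show "{e \<in> edges G. X 1 \<in> e} \<subseteq> (\<lambda>j. {X 1, Y j}) ` {1..n}"
    proof
      fix e assume e: "e \<in> {e \<in> edges G. X 1 \<in> e}"
      then obtain i j where "e = {X i, Y j}" "j \<in> {1..n}"
        using G unfolding ferrers_graph_def by blast
      then show "e \<in> (\<lambda>j. {X 1, Y j}) ` {1..n}" using e by auto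
    qed
    have "{X 1, Y j} \<in> edges G" if "j \<in> {1..n}" for j
    proof -
      have "\<forall>i j p q. {X i, Y j} \<in> edges G \<and> 1 \<le> p \<and> p \<le> i \<and> 1 \<le> q \<and> q \<le> j \<longrightarrow>
              {X p, Y q} \<in> edges G"
        using G unfolding ferrers_graph_def by (elim conjE)
      from this[rule_format, of 1 n 1 j] show ?thesis using 1(1) that by simp
    qed
    then show "(\<lambda>j. {X 1, Y j}) ` {1..n} \<subseteq> {e \<in> edges G. X 1 \<in> e}" by blast
  qed
  moreover have "inj_on (\<lambda>j. {X 1, Y j}) {1..n}" by (auto simp: inj_on_def doubleton_eq_iff)
  ultimately have "vertex_degree G (X 1) = n" by (simp add: vertex_degree_def card_image)
  then show ?thesis using \<open>m \<ge> 1\<close> by (simp add: ferrers_partition_def upt_conv_Cons del: upt_Suc)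
qed

end

theory Submission
  imports Defs
begin

text \<open>
  The equality with the Alexander dual holds for the edge ideal of every triangle-free graph
  \<open>G\<close> without isolated vertices and with at least one edge, and Ferrers graphs are of this
  kind: they are bipartite, and every \<open>x\<^sub>i\<close> is joined to \<open>y\<^sub>1\<close>, every \<open>y\<^sub>j\<close> to \<open>x\<^sub>1\<close>.

  Both sides are monomial ideals, so membership can be tested one term at a time, and since
  all generators are squarefree, only the support \<open>T\<close> of a term matters. As every vertex lies on
  an edge, the lcm of the generators of \<open>I(G)\<close> is the product of all vertices; hence a term lies
  in the LCM-dual iff \<open>T\<close> contains \<open>V - e\<close> for some edge \<open>e\<close>. A term lies in the Alexander
  dual of \<open>I(G\<^sup>c)\<close> iff \<open>T\<close> meets every non-edge, that is, iff \<open>V - T\<close> is a clique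
  of \<open>G\<close>. When there are no triangles, no isolated vertices and at least one edge, the cliques
  are exactly the subsets of edges, and \<open>V - T \<subseteq> e\<close> is the same as \<open>V - e \<subseteq> T\<close>.
  This is \<open>meets_nonedges_iff\<close>, and \<open>lcm_dual_eq_alexander_dual_complement\<close> draws the
  conclusion.

  The Alexander dual is by construction an intersection of ideals generated by variables, and
  these are prime. For primality, consider two polynomials outside the ideal. A unique-product
  argument (\<open>unique_sum_exponents\<close>) yields among the terms of the two that avoid the given
  variables a pair whose product cannot be cancelled by any other contribution.
\<close>

section \<open>Membership in monomial ideals\<close>

text \<open>
  The condition on \<open>P\<close> says that the monomials satisfying \<open>P\<close> absorb multiplication by
  monomials. Every term of \<open>x * a\<close> is the product of a term of \<open>x\<close> and one of \<open>a\<close>, and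
  every term of a sum is a term of a summand, so the polynomials composed of such monomials form
  an ideal.
\<close>

lemma ideal_of_exponents:
  fixes V :: "'v set"
  defines "R \<equiv> poly_ring V :: ('v, 'k::field) poly_fn ring"
  assumes up: "\<And>s t. P t \<Longrightarrow> P (s + t)"
  shows "ideal {p \<in> carrier R. \<forall>t\<in>Poly_Mapping.keys p. P t} R"
proof -
  interpret cring R unfolding R_def by (rule cring_poly_ring)
  define J where "J = {p \<in> carrier R. \<forall>t\<in>Poly_Mapping.keys p. P t}"
  have "ideal J R"
  proof (rule idealI)
    show "ring R" by (rule ring_axioms)
    show "subgroup J (add_monoid R)"
    proof (rule subgroup.intro)
      fix x y assume "x \<in> J" "y \<in> J"
      then show "x \<otimes>\<^bsub>add_monoid R\<^esub> y \<in> J"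
        using Poly_Mapping.keys_add[of x y] by (fastforce simp: J_def R_def)
    next
      fix x assume x: "x \<in> J"
      have "\<ominus>\<^bsub>R\<^esub> x = - x"
        using x by (intro minus_equality) (auto simp: J_def R_def)
      then show "inv\<^bsub>add_monoid R\<^esub> x \<in> J"
        using x unfolding a_inv_def[symmetric] by (auto simp: J_def R_def)
    qed (auto simp: J_def R_def)
    have prod_in: "x * a \<in> J" if a: "a \<in> J" and x: "x \<in> carrier R" for a x
    proof -
      have "x * a \<in> carrier R" using m_closed[of x a] a x by (simp add: J_def R_def)
      moreover have "P t" if "t \<in> Poly_Mapping.keys (x * a)" for t
        using that keys_mult[of x a] a up by (auto simp: J_def)
      ultimately show ?thesis by (auto simp: J_def)
    qed
    then show "x \<otimes>\<^bsub>R\<^esub> a \<in> J" if "a \<in> J" "x \<in> carrier R" for a x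
      using that by (simp add: R_def)
    show "a \<otimes>\<^bsub>R\<^esub> x \<in> J" if "a \<in> J" "x \<in> carrier R" for a x
      using prod_in[OF that] by (simp add: R_def mult.commute)
  qed
  then show ?thesis unfolding J_def .
qed

lemma poly_eq_sum_terms:
  fixes p :: "'a \<Rightarrow>\<^sub>0 'b::comm_monoid_add"
  shows "p = (\<Sum>t\<in>Poly_Mapping.keys p. Poly_Mapping.single t (Poly_Mapping.lookup p t))"
  by (rule poly_mapping_eqI) (simp add: lookup_sum lookup_single when_def in_keys_iff)

text \<open>
  The polynomials all of whose terms are multiples of generators form an ideal containing the
  generators. Conversely, such a polynomial is the sum of its terms, each of which is a multiple
  of a generator. This turns intersections and equality of monomial ideals into statements about
  single exponent vectors.
\<close>

lemma mem_Idl_monomials_iff: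
  fixes V :: "'v set"
  defines "R \<equiv> poly_ring V :: ('v, 'k::field) poly_fn ring"
  assumes A: "\<forall>a\<in>A. Poly_Mapping.keys a \<subseteq> V"
  shows "p \<in> Idl\<^bsub>R\<^esub> (monomial ` A) \<longleftrightarrow>
           p \<in> carrier R \<and> (\<forall>t\<in>Poly_Mapping.keys p. \<exists>a\<in>A. \<exists>c. t = a + c)"
proof -
  interpret cring R unfolding R_def by (rule cring_poly_ring)
  have sub: "monomial ` A \<subseteq> carrier R" using A by (auto simp: R_def)
  interpret I: ideal "Idl\<^bsub>R\<^esub> (monomial ` A)" R by (rule genideal_ideal[OF sub])
  define J where "J = {p \<in> carrier R. \<forall>t\<in>Poly_Mapping.keys p. \<exists>a\<in>A. \<exists>c. t = a + c}"
  have "ideal J R"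
    unfolding J_def R_def by (rule ideal_of_exponents) (metis add.left_commute)
  moreover have "monomial ` A \<subseteq> J"
    using A by (auto simp: J_def R_def) (metis add.right_neutral)
  ultimately have "Idl\<^bsub>R\<^esub> (monomial ` A) \<subseteq> J" by (rule genideal_minimal)
  moreover have "p \<in> Idl\<^bsub>R\<^esub> (monomial ` A)" if p: "p \<in> J"
  proof -
    have term_in: "Poly_Mapping.single t c \<in> Idl\<^bsub>R\<^esub> (monomial ` A)"
      if t: "t \<in> Poly_Mapping.keys p" for t c
    proof -
      have "monomial t \<in> Idl\<^bsub>R\<^esub> (monomial ` A)"
        unfolding R_def using p t by (subst mon_in_Idl_iff[OF A]) (auto simp: J_def R_def)
      moreover have "Poly_Mapping.single 0 c \<in> carrier R" by (simp add: R_def)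
      ultimately have "Poly_Mapping.single 0 c \<otimes>\<^bsub>R\<^esub> monomial t \<in> Idl\<^bsub>R\<^esub> (monomial ` A)"
        by (rule I.I_l_closed)
      then show ?thesis by (simp add: R_def monomial_def mult_single)
    qed
    have "(\<Sum>t\<in>S. Poly_Mapping.single t (Poly_Mapping.lookup p t)) \<in> Idl\<^bsub>R\<^esub> (monomial ` A)"
      if "finite S" "S \<subseteq> Poly_Mapping.keys p" for S
      using that
    proof induction
      case empty
      then show ?case using I.zero_closed by (simp add: R_def)
    next
      case (insert t S)
      then show ?case using I.a_closed term_in by (simp add: R_def)
    qed
    then show ?thesis using poly_eq_sum_terms[of p] by (metis finite_keys order_refl)
  qed
  ultimately show ?thesis unfolding J_def by blast
qed

section \<open>Squarefree monomials\<close>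

definition squarefree_exp :: "'v set \<Rightarrow> ('v \<Rightarrow>\<^sub>0 nat)" where
  "squarefree_exp \<sigma> = (\<Sum>z\<in>\<sigma>. Poly_Mapping.single z 1)"

lemma lookup_squarefree_exp:
  "finite \<sigma> \<Longrightarrow> Poly_Mapping.lookup (squarefree_exp \<sigma>) z = (if z \<in> \<sigma> then 1 else 0)"
  by (simp add: squarefree_exp_def lookup_sum lookup_single when_def)

lemma keys_squarefree_exp [simp]: "finite \<sigma> \<Longrightarrow> Poly_Mapping.keys (squarefree_exp \<sigma>) = \<sigma>"
  by (auto simp: in_keys_iff lookup_squarefree_exp split: if_splits)

lemma squarefree_exp_eq_iff:
  "finite \<sigma> \<Longrightarrow> finite \<tau> \<Longrightarrow> squarefree_exp \<sigma> = squarefree_exp \<tau> \<longleftrightarrow> \<sigma> = \<tau>"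
  by (metis keys_squarefree_exp)

lemma squarefree_exp_divides_iff:
  assumes "finite \<sigma>"
  shows "(\<exists>c. t = squarefree_exp \<sigma> + c) \<longleftrightarrow> \<sigma> \<subseteq> Poly_Mapping.keys t"
proof
  assume "\<exists>c. t = squarefree_exp \<sigma> + c"
  then show "\<sigma> \<subseteq> Poly_Mapping.keys t" using assms by (auto simp: keys_add_exp)
next
  assume "\<sigma> \<subseteq> Poly_Mapping.keys t"
  then have "t = squarefree_exp \<sigma> + (t - squarefree_exp \<sigma>)"
    using assms
    by (intro poly_mapping_eqI) (auto simp: lookup_add lookup_minus lookup_squarefree_exp in_keys_iff)
  then show "\<exists>c. t = squarefree_exp \<sigma> + c" by blast
qed

lemma mem_Idl_squarefree_iff:
  fixes V :: "'v set"
  defines "R \<equiv> poly_ring V :: ('v, 'k::field) poly_fn ring"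
  assumes "\<forall>\<sigma>\<in>F. finite \<sigma> \<and> \<sigma> \<subseteq> V"
  shows "p \<in> Idl\<^bsub>R\<^esub> (monomial ` squarefree_exp ` F) \<longleftrightarrow>
           p \<in> carrier R \<and> (\<forall>t\<in>Poly_Mapping.keys p. \<exists>\<sigma>\<in>F. \<sigma> \<subseteq> Poly_Mapping.keys t)"
proof -
  have "\<forall>a\<in>squarefree_exp ` F. Poly_Mapping.keys a \<subseteq> V" using assms by auto
  from mem_Idl_monomials_iff[OF this, of p] show ?thesis
    using assms by (auto simp: R_def squarefree_exp_divides_iff)
qed

lemma mem_Idl_vars_iff:
  fixes V :: "'v set"
  defines "R \<equiv> poly_ring V :: ('v, 'k::field) poly_fn ring"
  assumes "\<sigma> \<subseteq> V"
  shows "p \<in> Idl\<^bsub>R\<^esub> (var ` \<sigma>) \<longleftrightarrow>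
           p \<in> carrier R \<and> (\<forall>t\<in>Poly_Mapping.keys p. \<sigma> \<inter> Poly_Mapping.keys t \<noteq> {})"
proof -
  have vars: "var ` \<sigma> = monomial ` squarefree_exp ` (\<lambda>z. {z}) ` \<sigma>"
    by (simp add: image_image var_def squarefree_exp_def)
  have fin: "\<forall>\<tau>\<in>(\<lambda>z. {z}) ` \<sigma>. finite \<tau> \<and> \<tau> \<subseteq> V" using assms by auto
  have meets: "(\<exists>\<tau>\<in>(\<lambda>z. {z}) ` \<sigma>. \<tau> \<subseteq> T) \<longleftrightarrow> \<sigma> \<inter> T \<noteq> {}" for T by auto
  show ?thesis unfolding R_def vars mem_Idl_squarefree_iff[OF fin] meets ..
qed

section \<open>Ideals generated by variables are prime\<close>

text \<open>
  The pair of lexicographically largest elements has this property. The induction treats the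
  variables of \<open>W\<close> one at a time: an equal sum must be attained at maximal exponents of the
  new variable on both sides, so \<open>A\<close> and \<open>B\<close> can be restricted to the elements with maximal
  exponent.
\<close>

lemma unique_sum_exponents_on:
  fixes A B :: "('v \<Rightarrow>\<^sub>0 nat) set"
  assumes "finite W" "finite A" "A \<noteq> {}" "finite B" "B \<noteq> {}"
  shows "\<exists>a\<in>A. \<exists>b\<in>B. \<forall>a'\<in>A. \<forall>b'\<in>B. a' + b' = a + b \<longrightarrow>
           (\<forall>z\<in>W. Poly_Mapping.lookup a' z = Poly_Mapping.lookup a z)"
  using assms
proof (induction W arbitrary: A B)
  case empty
  then show ?case by auto
next
  case (insert z W)
  define max_exp :: "('v \<Rightarrow>\<^sub>0 nat) set \<Rightarrow> nat" where "max_exp C = Max ((\<lambda>c. Poly_Mapping.lookup c z) ` C)" for C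
  define crest where "crest C = {c \<in> C. Poly_Mapping.lookup c z = max_exp C}" for C
  have crest: "finite (crest C)" "crest C \<noteq> {}" if "finite C" "C \<noteq> {}" for C
  proof -
    have "max_exp C \<in> (\<lambda>c. Poly_Mapping.lookup c z) ` C"
      unfolding max_exp_def using that by (intro Max_in) auto
    then show "crest C \<noteq> {}" by (auto simp: crest_def)
  qed (use that in \<open>simp add: crest_def\<close>)
  have le_max_exp: "Poly_Mapping.lookup c z \<le> max_exp C" if "finite C" "c \<in> C" for c C
    unfolding max_exp_def using that by (intro Max_ge) auto
  obtain a b where ab: "a \<in> crest A" "b \<in> crest B"
    and uniq: "\<And>a' b'. a' \<in> crest A \<Longrightarrow> b' \<in> crest B \<Longrightarrow> a' + b' = a + b \<Longrightarrow>
                 \<forall>y\<in>W. Poly_Mapping.lookup a' y = Poly_Mapping.lookup a y"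
    using insert.IH[of "crest A" "crest B"] insert.prems crest by metis
  have "\<forall>y\<in>insert z W. Poly_Mapping.lookup a' y = Poly_Mapping.lookup a y"
    if a': "a' \<in> A" and b': "b' \<in> B" and eq: "a' + b' = a + b" for a' b'
  proof -
    have "Poly_Mapping.lookup a' z + Poly_Mapping.lookup b' z = max_exp A + max_exp B"
      using arg_cong[OF eq, of "\<lambda>t. Poly_Mapping.lookup t z"] ab
      by (simp add: lookup_add crest_def)
    then have "Poly_Mapping.lookup a' z = max_exp A" "Poly_Mapping.lookup b' z = max_exp B"
      using le_max_exp[OF _ a'] le_max_exp[OF _ b'] insert.prems by linarith+
    then show ?thesis using uniq[of a' b'] a' b' eq ab by (auto simp: crest_def)
  qed
  moreover have "a \<in> A" "b \<in> B" using ab by (simp_all add: crest_def)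
  ultimately show ?case by blast
qed

lemma unique_sum_exponents:
  fixes A B :: "('v \<Rightarrow>\<^sub>0 nat) set"
  assumes "finite A" "A \<noteq> {}" "finite B" "B \<noteq> {}"
  shows "\<exists>a\<in>A. \<exists>b\<in>B. \<forall>a'\<in>A. \<forall>b'\<in>B. a' + b' = a + b \<longrightarrow> a' = a \<and> b' = b"
proof -
  define W where "W = (\<Union>a\<in>A. Poly_Mapping.keys a)"
  have "finite W" using assms by (simp add: W_def)
  then obtain a b where ab: "a \<in> A" "b \<in> B"
    and uniq: "\<And>a' b'. a' \<in> A \<Longrightarrow> b' \<in> B \<Longrightarrow> a' + b' = a + b \<Longrightarrow>
                 \<forall>z\<in>W. Poly_Mapping.lookup a' z = Poly_Mapping.lookup a z"
    using unique_sum_exponents_on[of W A B] assms by metis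
  have "a' = a \<and> b' = b" if "a' \<in> A" "b' \<in> B" "a' + b' = a + b" for a' b'
  proof -
    have "a' = a"
    proof (rule poly_mapping_eqI)
      fix z
      show "Poly_Mapping.lookup a' z = Poly_Mapping.lookup a z"
      proof (cases "z \<in> W")
        case False
        then have "z \<notin> Poly_Mapping.keys a" "z \<notin> Poly_Mapping.keys a'"
          using ab that by (auto simp: W_def)
        then show ?thesis by (simp add: in_keys_iff)
      qed (use uniq[OF that] in blast)
    qed
    then show ?thesis using that by simp
  qed
  then show ?thesis using ab by blast
qed

lemma lookup_mult_unique_sum:
  fixes p q :: "('v, 'k::field) poly_fn"
  assumes "\<And>s t. s \<in> Poly_Mapping.keys p \<Longrightarrow> t \<in> Poly_Mapping.keys q \<Longrightarrow> s + t = a + b \<Longrightarrow> s = a \<and> t = b"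
  shows "Poly_Mapping.lookup (p * q) (a + b) = Poly_Mapping.lookup p a * Poly_Mapping.lookup q b"
proof -
  have inner: "Poly_Mapping.lookup p s * (\<Sum>t. Poly_Mapping.lookup q t when a + b = s + t)
             = (Poly_Mapping.lookup p s * Poly_Mapping.lookup q b when s = a)" for s
  proof (cases "s \<in> Poly_Mapping.keys p")
    case True
    have "(Poly_Mapping.lookup q t when a + b = s + t)
        = ((Poly_Mapping.lookup q t when s = a) when t = b)" for t
      using assms[OF True, of t, OF _ sym] by (auto simp: when_def in_keys_iff)
    then show ?thesis by (simp add: mult_when)
  next
    case False
    then show ?thesis by (simp add: in_keys_iff)
  qed
  show ?thesis unfolding lookup_mult inner by simp
qed

text \<open>
  The ideal is even prime. The terms of \<open>p\<close> and \<open>q\<close> that avoid \<open>\<sigma>\<close> represent \<open>p\<close> and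
  \<open>q\<close> modulo the ideal; if both have such terms, the pair with unique sum contributes to
  \<open>p * q\<close> a term that avoids \<open>\<sigma>\<close>.
\<close>

lemma primary_ideal_vars:
  fixes V :: "'v set"
  defines "R \<equiv> poly_ring V :: ('v, 'k::field) poly_fn ring"
  assumes "\<sigma> \<subseteq> V"
  shows "primary_ideal R (Idl\<^bsub>R\<^esub> (var ` \<sigma>))"
proof -
  interpret cring R unfolding R_def by (rule cring_poly_ring)
  let ?Q = "Idl\<^bsub>R\<^esub> (var ` \<sigma>)"
  have in_iff: "p \<in> ?Q \<longleftrightarrow>
      p \<in> carrier R \<and> (\<forall>t\<in>Poly_Mapping.keys p. \<sigma> \<inter> Poly_Mapping.keys t \<noteq> {})" for p
    unfolding R_def by (rule mem_Idl_vars_iff) (use assms in simp)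
  have "ideal ?Q R"
    using assms by (intro genideal_ideal) (auto simp: R_def var_def)
  moreover have "?Q \<noteq> carrier R"
  proof -
    have "1 \<in> carrier R" using one_closed by (simp add: R_def)
    moreover have "1 \<notin> ?Q" by (simp add: in_iff)
    ultimately show ?thesis by blast
  qed
  moreover have prime: "p \<in> ?Q \<or> q \<in> ?Q"
    if p: "p \<in> carrier R" and q: "q \<in> carrier R" and pq: "p \<otimes>\<^bsub>R\<^esub> q \<in> ?Q" for p q
  proof (rule ccontr)
    define A where "A r = {t \<in> Poly_Mapping.keys r. \<sigma> \<inter> Poly_Mapping.keys t = {}}"
      for r :: "('v, 'k) poly_fn"
    assume "\<not> (p \<in> ?Q \<or> q \<in> ?Q)"
    then have "A p \<noteq> {}" "A q \<noteq> {}" using p q by (auto simp: in_iff A_def)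
    moreover have "finite (A p)" "finite (A q)" by (simp_all add: A_def)
    ultimately obtain a b where ab: "a \<in> A p" "b \<in> A q"
      and uniq: "\<And>a' b'. a' \<in> A p \<Longrightarrow> b' \<in> A q \<Longrightarrow> a' + b' = a + b \<Longrightarrow> a' = a \<and> b' = b"
      using unique_sum_exponents[of "A p" "A q"] by metis
    have disj: "\<sigma> \<inter> Poly_Mapping.keys (a + b) = {}"
      using ab by (auto simp: A_def keys_add_exp)
    have "Poly_Mapping.lookup (p * q) (a + b) = Poly_Mapping.lookup p a * Poly_Mapping.lookup q b"
    proof (rule lookup_mult_unique_sum)
      fix s t assume st: "s \<in> Poly_Mapping.keys p" "t \<in> Poly_Mapping.keys q" "s + t = a + b"
      \<comment> \<open>Factors of a term that avoids \<open>\<sigma>\<close> avoid \<open>\<sigma>\<close> as well.\<close>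
      have "\<sigma> \<inter> (Poly_Mapping.keys s \<union> Poly_Mapping.keys t) = {}"
        using disj unfolding st(3)[symmetric] keys_add_exp .
      then have "s \<in> A p" "t \<in> A q" using st(1,2) by (auto simp: A_def)
      then show "s = a \<and> t = b" using uniq st by blast
    qed
    then have "a + b \<in> Poly_Mapping.keys (p * q)" using ab by (auto simp: A_def in_keys_iff)
    moreover have "p * q \<in> ?Q" using pq by (simp add: R_def)
    ultimately show False using disj in_iff by blast
  qed
  moreover have "p \<in> ?Q \<or> (\<exists>k::nat. k \<ge> 1 \<and> q [^]\<^bsub>R\<^esub> k \<in> ?Q)"
    if "p \<in> carrier R" "q \<in> carrier R" "p \<otimes>\<^bsub>R\<^esub> q \<in> ?Q" for p q
  proof -
    have "q [^]\<^bsub>R\<^esub> (1::nat) = q" using that by simp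
    then show ?thesis using prime[OF that] by (metis order_refl)
  qed
  ultimately show ?thesis unfolding primary_ideal_def by blast
qed

section \<open>Edge ideals and their duals\<close>

lemma finite_edges: "simple_graph G \<Longrightarrow> finite (edges G)"
  unfolding simple_graph_def by (meson Pow_iff finite_Pow_iff finite_subset subsetI)

lemma finite_edge: "simple_graph G \<Longrightarrow> e \<in> edges G \<Longrightarrow> finite e"
  unfolding simple_graph_def using finite_subset by blast

lemma edge_ideal_eq:
  fixes R :: "('v, 'k::field) poly_fn ring"
  assumes G: "simple_graph G"
  shows "edge_ideal R G = Idl\<^bsub>R\<^esub> (monomial ` squarefree_exp ` edges G)"
proof -
  have prod_vars: "var u * var v = (monomial (squarefree_exp {u, v}) :: ('v, 'k) poly_fn)"
    if "{u, v} \<in> edges G" for u v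
  proof -
    have "card {u, v} = 2" using G that by (auto simp: simple_graph_def)
    then have "u \<noteq> v" by auto
    then show ?thesis by (simp add: var_def mon_mult squarefree_exp_def)
  qed
  have "{var u * var v :: ('v, 'k) poly_fn | u v. {u, v} \<in> edges G}
      = monomial ` squarefree_exp ` edges G"
  proof (intro subset_antisym subsetI)
    fix p :: "('v, 'k) poly_fn"
    assume "p \<in> {var u * var v | u v. {u, v} \<in> edges G}"
    then show "p \<in> monomial ` squarefree_exp ` edges G" using prod_vars by auto
  next
    fix p :: "('v, 'k) poly_fn"
    assume "p \<in> monomial ` squarefree_exp ` edges G"
    then obtain e where e: "e \<in> edges G" "p = monomial (squarefree_exp e)" by blast
    then have "card e = 2" using G by (simp add: simple_graph_def)
    then obtain u v where "e = {u, v}" by (auto simp: card_2_iff)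
    then have "{u, v} \<in> edges G" "p = var u * var v" using e prod_vars by simp_all
    then show "p \<in> {var u * var v | u v. {u, v} \<in> edges G}" by blast
  qed
  then show ?thesis by (simp add: edge_ideal_def)
qed

text \<open>All generators have the same degree, so none divides another.\<close>

lemma min_mon_gens_edge_ideal:
  assumes G: "simple_graph G" and V: "verts G \<subseteq> V"
  shows "min_mon_gens (poly_ring V :: ('v, 'k::field) poly_fn ring) (edge_ideal (poly_ring V) G)
           = squarefree_exp ` edges G"
proof -
  let ?A = "squarefree_exp ` edges G"
  have A: "\<forall>a\<in>?A. Poly_Mapping.keys a \<subseteq> V"
    using G V finite_edge[OF G] by (fastforce simp: simple_graph_def)
  have "d = a" if ad: "a \<in> ?A" "d \<in> ?A" "a = d + c" for a d c
  proof -
    obtain e f where ef: "e \<in> edges G" "a = squarefree_exp e" "f \<in> edges G" "d = squarefree_exp f"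
      using ad(1,2) by blast
    have "f \<subseteq> e"
      using ad(3) ef finite_edge[OF G] by (metis squarefree_exp_divides_iff keys_squarefree_exp)
    then have "f = e" using G ef finite_edge[OF G] by (simp add: simple_graph_def card_subset_eq)
    then show ?thesis using ef by simp
  qed
  then have "{a \<in> ?A. \<forall>d\<in>?A. (\<exists>c. a = d + c) \<longrightarrow> d = a} = ?A" by blast
  then show ?thesis
    unfolding min_mon_gens_def edge_ideal_eq[OF G] is_min_mon_gens_iff[OF A] by simp
qed

lemma lcm_exp_squarefree:
  assumes "finite F" "\<forall>\<sigma>\<in>F. finite \<sigma>"
  shows "lcm_exp (squarefree_exp ` F) = squarefree_exp (\<Union>F)"
proof (rule poly_mapping_eqI)
  fix z
  show "Poly_Mapping.lookup (lcm_exp (squarefree_exp ` F)) z = Poly_Mapping.lookup (squarefree_exp (\<Union>F)) z"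
  proof (cases "F = {}")
    case True
    then show ?thesis by (simp add: lookup_lcm_exp squarefree_exp_def)
  next
    case False
    have "(\<lambda>t. Poly_Mapping.lookup t z) ` squarefree_exp ` F = (\<lambda>\<sigma>. if z \<in> \<sigma> then 1 else 0) ` F"
      using assms by (force simp: image_image lookup_squarefree_exp)
    moreover have "Max ((\<lambda>\<sigma>. if z \<in> \<sigma> then 1 else (0::nat)) ` F) = (if z \<in> \<Union>F then 1 else 0)"
      using assms False by (intro Max_eqI) auto
    ultimately show ?thesis using assms False by (simp add: lookup_lcm_exp lookup_squarefree_exp)
  qed
qed

lemma squarefree_exp_diff:
  assumes "finite \<sigma>" "\<tau> \<subseteq> \<sigma>"
  shows "squarefree_exp \<sigma> - squarefree_exp \<tau> = squarefree_exp (\<sigma> - \<tau>)"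
  using assms finite_subset[OF assms(2,1)]
  by (intro poly_mapping_eqI) (auto simp: lookup_minus lookup_squarefree_exp)

lemma lcm_dual_edge_ideal:
  fixes G :: "'v ugraph"
  defines "R \<equiv> poly_ring (verts G) :: ('v, 'k::field) poly_fn ring"
  assumes G: "simple_graph G"
  shows "lcm_dual R (edge_ideal R G)
           = Idl\<^bsub>R\<^esub> (monomial ` squarefree_exp ` (\<lambda>e. \<Union>(edges G) - e) ` edges G)"
proof -
  have gens: "min_mon_gens R (edge_ideal R G) = squarefree_exp ` edges G"
    unfolding R_def by (rule min_mon_gens_edge_ideal[OF G]) simp
  have lcm: "lcm_exp (squarefree_exp ` edges G) = squarefree_exp (\<Union>(edges G))"
    using finite_edges[OF G] finite_edge[OF G] by (intro lcm_exp_squarefree) auto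
  have "squarefree_exp (\<Union>(edges G)) - squarefree_exp e = squarefree_exp (\<Union>(edges G) - e)"
    if "e \<in> edges G" for e
    using that finite_edges[OF G] finite_edge[OF G] by (intro squarefree_exp_diff) auto
  then have "{monomial (squarefree_exp (\<Union>(edges G)) - f) :: ('v, 'k) poly_fn | f. f \<in> squarefree_exp ` edges G}
      = monomial ` squarefree_exp ` (\<lambda>e. \<Union>(edges G) - e) ` edges G"
    by (force simp: image_iff)
  then show ?thesis unfolding lcm_dual_def gens lcm by simp
qed

lemma alexander_dual_edge_ideal:
  fixes V :: "'v set"
  defines "R \<equiv> poly_ring V :: ('v, 'k::field) poly_fn ring"
  assumes G: "simple_graph G" and V: "verts G \<subseteq> V"
  shows "alexander_dual R (edge_ideal R G) = carrier R \<inter> (\<Inter>e\<in>edges G. Idl\<^bsub>R\<^esub> (var ` e))"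
proof -
  have gens: "min_mon_gens R (edge_ideal R G) = squarefree_exp ` edges G"
    unfolding R_def by (rule min_mon_gens_edge_ideal[OF G V])
  have "finite \<sigma> \<and> squarefree_exp \<sigma> \<in> squarefree_exp ` edges G \<longleftrightarrow> \<sigma> \<in> edges G" for \<sigma>
    using finite_edge[OF G] by (auto simp: squarefree_exp_eq_iff)
  then have "{Idl\<^bsub>R\<^esub> (var ` \<sigma>) | \<sigma>. finite \<sigma> \<and> squarefree_exp \<sigma> \<in> squarefree_exp ` edges G}
      = (\<lambda>e. Idl\<^bsub>R\<^esub> (var ` e)) ` edges G"
    by auto
  then show ?thesis
    unfolding alexander_dual_def gens squarefree_exp_def[symmetric] by simp
qed

lemma primary_decomposition_alexander_dual:
  fixes V :: "'v set"
  defines "R \<equiv> poly_ring V :: ('v, 'k::field) poly_fn ring"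
  assumes G: "simple_graph G" and V: "verts G \<subseteq> V"
  shows "primary_decomposition R (alexander_dual R (edge_ideal R G))
           ((\<lambda>e. Idl\<^bsub>R\<^esub> (var ` e)) ` edges G)"
proof -
  have "primary_ideal R (Idl\<^bsub>R\<^esub> (var ` e))" if "e \<in> edges G" for e
    unfolding R_def by (rule primary_ideal_vars) (use G V that in \<open>auto simp: simple_graph_def\<close>)
  then show ?thesis
    using finite_edges[OF G] alexander_dual_edge_ideal[OF G V]
    by (auto simp: primary_decomposition_def R_def)
qed

section \<open>Triangle-free graphs\<close>

text \<open>
  The left-hand side says that the vertices outside \<open>T\<close> form a clique, and the right-hand side
  that they lie in an edge. Without triangles a clique has at most two elements; the cliques of
  size 0 and 1 lie in an edge because there is an edge, respectively no isolated vertex.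
\<close>

lemma meets_nonedges_iff:
  assumes G: "simple_graph G"
    and nonempty: "edges G \<noteq> {}"
    and no_isolated: "\<Union>(edges G) = verts G"
    and triangle_free: "\<And>u v w. {u, v} \<in> edges G \<Longrightarrow> {v, w} \<in> edges G \<Longrightarrow> {u, w} \<notin> edges G"
  shows "(\<forall>f\<in>edges (graph_complement G). f \<inter> T \<noteq> {}) \<longleftrightarrow> (\<exists>e\<in>edges G. verts G - e \<subseteq> T)"
proof
  assume meets: "\<forall>f\<in>edges (graph_complement G). f \<inter> T \<noteq> {}"
  have clique: "{u, v} \<in> edges G" if "u \<in> verts G - T" "v \<in> verts G - T" "u \<noteq> v" for u v
  proof (rule ccontr)
    assume "{u, v} \<notin> edges G"
    then have "{u, v} \<in> edges (graph_complement G)"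
      using that by (auto simp: graph_complement_def)
    then have "{u, v} \<inter> T \<noteq> {}" by (rule meets[rule_format])
    then show False using that by auto
  qed
  have "\<exists>e\<in>edges G. verts G - T \<subseteq> e"
  proof (cases "\<exists>u v. u \<in> verts G - T \<and> v \<in> verts G - T \<and> u \<noteq> v")
    case True
    then obtain u v where uv: "u \<in> verts G - T" "v \<in> verts G - T" "u \<noteq> v" by blast
    have "w = u \<or> w = v" if "w \<in> verts G - T" for w
      using clique[OF uv] clique[of v w] clique[of u w] triangle_free[of u v w] uv that by blast
    then show ?thesis using clique[OF uv] by blast
  next
    case False
    show ?thesis
    proof (cases "verts G - T = {}")
      case True
      then show ?thesis using nonempty by auto
    next
      case nontrivial: False
      then obtain u where u: "u \<in> verts G - T" by blast
      then have "u \<in> \<Union>(edges G)" using no_isolated by simp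
      then obtain e where "e \<in> edges G" "u \<in> e" by blast
      moreover have "verts G - T \<subseteq> {u}" using False u by blast
      ultimately show ?thesis by blast
    qed
  qed
  then show "\<exists>e\<in>edges G. verts G - e \<subseteq> T" by blast
next
  assume "\<exists>e\<in>edges G. verts G - e \<subseteq> T"
  then obtain e where e: "e \<in> edges G" "verts G - e \<subseteq> T" by blast
  have "{u, v} \<inter> T \<noteq> {}"
    if "u \<in> verts G" "v \<in> verts G" "u \<noteq> v" "{u, v} \<notin> edges G" for u v
  proof
    assume "{u, v} \<inter> T = {}"
    then have "{u, v} \<subseteq> e" using that e by blast
    moreover have "card e = 2" "finite e" using G e finite_edge[OF G e(1)] by (simp_all add: simple_graph_def)
    ultimately have "{u, v} = e" using that by (intro card_subset_eq) auto
    then show False using that e by simp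
  qed
  then show "\<forall>f\<in>edges (graph_complement G). f \<inter> T \<noteq> {}"
    by (auto simp: graph_complement_def)
qed

theorem lcm_dual_eq_alexander_dual_complement:
  fixes G :: "'v ugraph"
  defines "R \<equiv> poly_ring (verts G) :: ('v, 'k::field) poly_fn ring"
  assumes G: "simple_graph G"
    and nonempty: "edges G \<noteq> {}"
    and no_isolated: "\<Union>(edges G) = verts G"
    and triangle_free: "\<And>u v w. {u, v} \<in> edges G \<Longrightarrow> {v, w} \<in> edges G \<Longrightarrow> {u, w} \<notin> edges G"
  shows "lcm_dual R (edge_ideal R G) = alexander_dual R (edge_ideal R (graph_complement G))"
proof -
  let ?H = "graph_complement G"
  have H: "simple_graph ?H" by (rule simple_graph_complement[OF G])
  have vertsH: "verts ?H = verts G" by (simp add: graph_complement_def)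
  have dual: "alexander_dual R (edge_ideal R ?H) = carrier R \<inter> (\<Inter>e\<in>edges ?H. Idl\<^bsub>R\<^esub> (var ` e))"
    unfolding R_def by (rule alexander_dual_edge_ideal[OF H]) (simp add: vertsH)
  have "finite (verts G)" using G by (simp add: simple_graph_def)
  then have fin: "\<forall>\<sigma>\<in>(\<lambda>e. verts G - e) ` edges G. finite \<sigma> \<and> \<sigma> \<subseteq> verts G" by auto
  show ?thesis
  proof (rule Set.set_eqI)
    fix p
    have "p \<in> lcm_dual R (edge_ideal R G) \<longleftrightarrow>
        p \<in> carrier R \<and> (\<forall>t\<in>Poly_Mapping.keys p. \<exists>e\<in>edges G. verts G - e \<subseteq> Poly_Mapping.keys t)"
      unfolding R_def lcm_dual_edge_ideal[OF G] no_isolated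
      by (subst mem_Idl_squarefree_iff[OF fin]) simp
    also have "\<dots> \<longleftrightarrow> p \<in> carrier R \<and>
        (\<forall>t\<in>Poly_Mapping.keys p. \<forall>f\<in>edges ?H. f \<inter> Poly_Mapping.keys t \<noteq> {})"
      using meets_nonedges_iff[OF G nonempty no_isolated triangle_free] by simp
    also have "\<dots> \<longleftrightarrow> p \<in> alexander_dual R (edge_ideal R ?H)"
    proof -
      have "p \<in> Idl\<^bsub>R\<^esub> (var ` f) \<longleftrightarrow>
          p \<in> carrier R \<and> (\<forall>t\<in>Poly_Mapping.keys p. f \<inter> Poly_Mapping.keys t \<noteq> {})"
        if "f \<in> edges ?H" for f
        unfolding R_def
        by (rule mem_Idl_vars_iff) (use H that in \<open>simp add: simple_graph_def vertsH\<close>)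
      then show ?thesis unfolding dual by auto
    qed
    finally show "p \<in> lcm_dual R (edge_ideal R G) \<longleftrightarrow> p \<in> alexander_dual R (edge_ideal R ?H)" .
  qed
qed

section \<open>Ferrers graphs\<close>

lemma ferrers_edge_iff:
  assumes "ferrers_graph m n G"
  shows "e \<in> edges G \<longleftrightarrow> (\<exists>i j. e = {X i, Y j} \<and> i \<in> {1..m} \<and> j \<in> {1..n} \<and> {X i, Y j} \<in> edges G)"
  using assms unfolding ferrers_graph_def by blast

lemma ferrers_no_isolated:
  assumes G: "ferrers_graph m n G"
  shows "\<Union>(edges G) = verts G"
proof
  show "\<Union>(edges G) \<subseteq> verts G"
    using simple_graph_ferrers_graph[OF G] by (auto simp: simple_graph_def)
  have corners: "{X 1, Y n} \<in> edges G" "{X m, Y 1} \<in> edges G"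
    and down: "\<And>i j p q. {X i, Y j} \<in> edges G \<Longrightarrow> 1 \<le> p \<Longrightarrow> p \<le> i \<Longrightarrow> 1 \<le> q \<Longrightarrow> q \<le> j \<Longrightarrow>
                 {X p, Y q} \<in> edges G"
    and verts: "verts G = xyvars m n"
    using G unfolding ferrers_graph_def by (blast+)
  show "verts G \<subseteq> \<Union>(edges G)"
  proof
    fix z assume "z \<in> verts G"
    then consider i where "z = X i" "1 \<le> i" "i \<le> m" | j where "z = Y j" "1 \<le> j" "j \<le> n"
      unfolding verts xyvars_def by auto
    then show "z \<in> \<Union>(edges G)"
    proof cases
      case 1
      then have "{X i, Y 1} \<in> edges G" using down[OF corners(2), of i 1] by simp
      then show ?thesis using 1 by blast
    next
      case 2
      then have "{X 1, Y j} \<in> edges G" using down[OF corners(1), of 1 j] by simp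
      then show ?thesis using 2 by blast
    qed
  qed
qed

lemma ferrers_triangle_free:
  assumes G: "ferrers_graph m n G" and "{u, v} \<in> edges G" "{v, w} \<in> edges G"
  shows "{u, w} \<notin> edges G"
  using assms(2,3) ferrers_edge_iff[OF G, of "{u, v}"] ferrers_edge_iff[OF G, of "{v, w}"]
    ferrers_edge_iff[OF G, of "{u, w}"]
  by (auto simp: doubleton_eq_iff)

lemma var_prod_in_edge_ideal_iff:
  assumes G: "simple_graph G" and V: "verts G \<subseteq> V" and uv: "u \<in> V" "v \<in> V" "u \<noteq> v"
  shows "(var u * var v :: ('v, 'k::field) poly_fn) \<in> edge_ideal (poly_ring V) G \<longleftrightarrow> {u, v} \<in> edges G"
proof -
  have "var u * var v = (monomial (squarefree_exp {u, v}) :: ('v, 'k) poly_fn)"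
    using uv by (simp add: var_def mon_mult squarefree_exp_def)
  moreover have "\<forall>\<sigma>\<in>edges G. finite \<sigma> \<and> \<sigma> \<subseteq> V"
    using G V finite_edge[OF G] by (auto simp: simple_graph_def)
  ultimately have "(var u * var v :: ('v, 'k) poly_fn) \<in> edge_ideal (poly_ring V) G \<longleftrightarrow>
      (\<exists>e\<in>edges G. e \<subseteq> {u, v})"
    using uv by (simp add: edge_ideal_eq[OF G] mem_Idl_squarefree_iff del: poly_ring_simps(1))
      (simp add: poly_ring_simps(1))
  also have "\<dots> \<longleftrightarrow> {u, v} \<in> edges G"
  proof
    assume "\<exists>e\<in>edges G. e \<subseteq> {u, v}"
    then obtain e where e: "e \<in> edges G" "e \<subseteq> {u, v}" by blast
    have "card e = 2" using G e by (auto simp: simple_graph_def)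
    then have "e = {u, v}" using e uv by (intro card_subset_eq) auto
    then show "{u, v} \<in> edges G" using e by simp
  qed blast
  finally show ?thesis .
qed

lemma edges_ferrers_complement:
  assumes G: "ferrers_graph m n G"
  shows "edges (graph_complement G) =
           {{X i, X j} | i j. 1 \<le> i \<and> i < j \<and> j \<le> m} \<union>
           {{Y i, Y j} | i j. 1 \<le> i \<and> i < j \<and> j \<le> n} \<union>
           {{X i, Y j} | i j. 1 \<le> i \<and> i \<le> m \<and> 1 \<le> j \<and> j \<le> n \<and> {X i, Y j} \<notin> edges G}"
    (is "_ = ?XX \<union> ?YY \<union> ?XY")
proof
  have verts: "verts G = xyvars m n" using G by (simp add: ferrers_graph_def)
  show "edges (graph_complement G) \<subseteq> ?XX \<union> ?YY \<union> ?XY"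
  proof
    fix f assume "f \<in> edges (graph_complement G)"
    then obtain u v where f: "f = {u, v}" "u \<in> xyvars m n" "v \<in> xyvars m n" "u \<noteq> v" "f \<notin> edges G"
      by (auto simp: graph_complement_def verts)
    show "f \<in> ?XX \<union> ?YY \<union> ?XY"
    proof (cases u; cases v)
      fix i j assume "u = X i" "v = X j"
      then have "f = {X (min i j), X (max i j)}" "1 \<le> min i j" "min i j < max i j" "max i j \<le> m"
        using f by (auto simp: xyvars_def min_def max_def)
      then show ?thesis by blast
    next
      fix i j assume "u = Y i" "v = Y j"
      then have "f = {Y (min i j), Y (max i j)}" "1 \<le> min i j" "min i j < max i j" "max i j \<le> n"
        using f by (auto simp: xyvars_def min_def max_def)
      then show ?thesis by blast
    next
      fix i j assume "u = X i" "v = Y j"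
      then have "f = {X i, Y j}" "1 \<le> i" "i \<le> m" "1 \<le> j" "j \<le> n" using f by (auto simp: xyvars_def)
      then have "f \<in> ?XY" using f(5) by blast
      then show ?thesis by blast
    next
      fix i j assume "u = Y i" "v = X j"
      then have "f = {X j, Y i}" "1 \<le> j" "j \<le> m" "1 \<le> i" "i \<le> n" using f by (auto simp: xyvars_def)
      then have "f \<in> ?XY" using f(5) by blast
      then show ?thesis by blast
    qed
  qed
  have same_side: "{X i, X j} \<notin> edges G" "{Y i, Y j} \<notin> edges G" for i j
    by (subst ferrers_edge_iff[OF G], simp add: doubleton_eq_iff)+
  have nonedge: "{u, v} \<in> edges (graph_complement G)"
    if "u \<in> xyvars m n" "v \<in> xyvars m n" "u \<noteq> v" "{u, v} \<notin> edges G" for u v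
    using that by (auto simp: graph_complement_def verts)
  show "?XX \<union> ?YY \<union> ?XY \<subseteq> edges (graph_complement G)"
    by (auto intro!: nonedge simp: same_side xyvars_def)
qed

theorem theorem3p1:
  fixes m n :: nat
    and G :: "xyvar ugraph"
    and lam :: "nat list"
    and R :: "(xyvar, 'k::field) poly_fn ring"
    and I :: "(xyvar, 'k) poly_fn set"
  assumes "R = poly_ring (xyvars m n)"
    and "ferrers_graph m n G"
    and "lam = ferrers_partition m G"
    and "I = edge_ideal R G"
  shows "primary_decomposition R (lcm_dual R I)
           ({Idl\<^bsub>R\<^esub> {var (X i), var (X j)} | i j. 1 \<le> i \<and> i < j \<and> j \<le> m} \<union>
            {Idl\<^bsub>R\<^esub> {var (Y i), var (Y j)} | i j. 1 \<le> i \<and> i < j \<and> j \<le> n} \<union>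
            {Idl\<^bsub>R\<^esub> {var (X i), var (Y j)} | i j. 1 \<le> i \<and> i \<le> m \<and> 1 \<le> j \<and> j \<le> n \<and>
                                                var (X i) * var (Y j) \<notin> I}) \<and>
         lcm_dual R I = alexander_dual R (edge_ideal R (graph_complement G))"
proof -
  let ?H = "graph_complement G"
  have simple: "simple_graph G" by (rule simple_graph_ferrers_graph[OF assms(2)])
  have verts: "verts G = xyvars m n" using assms(2) by (simp add: ferrers_graph_def)
  have R: "R = poly_ring (verts G)" using assms(1) verts by simp
  have nonempty: "edges G \<noteq> {}" using assms(2) by (auto simp: ferrers_graph_def)
  have duals: "lcm_dual R I = alexander_dual R (edge_ideal R ?H)"
    unfolding assms(4) R
    by (rule lcm_dual_eq_alexander_dual_complement[OF simple nonempty
          ferrers_no_isolated[OF assms(2)] ferrers_triangle_free[OF assms(2)]])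
  have decomp: "primary_decomposition R (lcm_dual R I) ((\<lambda>e. Idl\<^bsub>R\<^esub> (var ` e)) ` edges ?H)"
    unfolding duals unfolding R
    by (rule primary_decomposition_alexander_dual[OF simple_graph_complement[OF simple]])
      (simp add: graph_complement_def)
  have in_I: "(var (X i) * var (Y j) :: (xyvar, 'k) poly_fn) \<in> I \<longleftrightarrow> {X i, Y j} \<in> edges G"
    if "1 \<le> i" "i \<le> m" "1 \<le> j" "j \<le> n" for i j
    unfolding assms(1,4)
    by (rule var_prod_in_edge_ideal_iff[OF simple]) (use that verts in \<open>auto simp: xyvars_def\<close>)
  have image_compr: "h ` {g i j | i j. P i j} = {h (g i j) | i j. P i j}"
    for h :: "xyvar set \<Rightarrow> (xyvar, 'k) poly_fn set" and g :: "nat \<Rightarrow> nat \<Rightarrow> xyvar set" and P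
    by blast
  have "(\<lambda>e. Idl\<^bsub>R\<^esub> (var ` e)) ` edges ?H =
      {Idl\<^bsub>R\<^esub> {var (X i), var (X j)} | i j. 1 \<le> i \<and> i < j \<and> j \<le> m} \<union>
      {Idl\<^bsub>R\<^esub> {var (Y i), var (Y j)} | i j. 1 \<le> i \<and> i < j \<and> j \<le> n} \<union>
      {Idl\<^bsub>R\<^esub> {var (X i), var (Y j)} | i j. 1 \<le> i \<and> i \<le> m \<and> 1 \<le> j \<and> j \<le> n \<and>
                                          {X i, Y j} \<notin> edges G}"
    (is "?L = ?XX \<union> ?YY \<union> ?XY")
    unfolding edges_ferrers_complement[OF assms(2)] image_Un
    by (simp only: image_compr image_insert image_empty)
  also have "?XY = {Idl\<^bsub>R\<^esub> {var (X i), var (Y j)} | i j. 1 \<le> i \<and> i \<le> m \<and> 1 \<le> j \<and> j \<le> n \<and>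
                                          var (X i) * var (Y j) \<notin> I}"
    by (intro Collect_cong ex_cong1) (auto simp: in_I)
  finally show ?thesis using decomp duals by simp
qed

end
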